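(* Let $\Theta\subseteq\mathbb{R}^m$, let $\mathcal{G}:\Theta\to\mathbb{R}^n$ be a measurable map with range $\mathcal{R}=\mathcal{G}(\Theta)$, and let $\rho_y$ be a probability measure on $\mathbb{R}^n$ with $\operatorname{supp}(\rho_y)\subseteq\mathcal{R}$. Consider the problem $$\min\left\{\int|x|^2\,\mathrm{d}\rho_x(x)\;:\;\rho_x\in\mathcal{P}_2(\Theta),\ \mathcal{G}_\#\rho_x=\rho_y\right\}.$$ Its optimizer is $$\rho_x^*=\mathcal{H}_\#\rho_y,$$ i.e. $\mathcal{H}_\#\rho_y$ solves the problem, where $\mathcal{H}(y)$ is the minimal-norm solution to $\mathcal{G}(x)=y$ in Euclidean space: $$\mathcal{H}(y):=\operatorname{arg\,min}_{x\in\Theta,\ \mathcal{G}(x)=y}|x|^2 .$$ If the minimum defining $\mathcal{H}(y)$ is attained at more than one point, one has the freedom to choose one.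
   Context: $\mathcal{P}_2(\Theta)$ is the set of probability measures on $\Theta$ with finite second moment, $\#$ denotes pushforward, and $|\cdot|$ is the Euclidean norm. The minimization problem is assumed to be well-posed (in particular the feasible set is nonempty), and the pointwise minimizers defining $\mathcal{H}$ on $\mathcal{R}$ are assumed to exist, with $\mathcal{H}:\mathcal{R}\to\Theta$ a fixed measurable selection of them. *)

theory Defs
  imports "HOL-Probability.Probability"
begin

definition msupport :: "'a::topological_space measure \<Rightarrow> 'a set" where
  "msupport \<mu> = {x. \<forall>U. open U \<longrightarrow> x \<in> U \<longrightarrow> emeasure \<mu> U > 0}"

text \<open>A set \<open>\<Theta>\<close> of points, not necessarily Borel, carries the trace of the Borel sigma-algebra of the
  ambient space; a measure on \<open>\<Theta>\<close> is one whose underlying space is \<open>\<Theta>\<close> itself.\<close>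

abbreviation borel_on :: "'a::topological_space set \<Rightarrow> 'a measure" where
  "borel_on \<Theta> \<equiv> restrict_space borel \<Theta>"

definition P2 :: "'a::euclidean_space set \<Rightarrow> 'a measure set" where
  "P2 \<Theta> = {\<rho>. prob_space \<rho> \<and> sets \<rho> = sets (borel_on \<Theta>) \<and> integrable \<rho> (\<lambda>x. (norm x)\<^sup>2)}"

definition feasible ::
    "'a::euclidean_space set \<Rightarrow> ('a \<Rightarrow> 'b::euclidean_space) \<Rightarrow> 'b measure \<Rightarrow> 'a measure \<Rightarrow> bool" where
  "feasible \<Theta> G \<rho>y \<rho>x \<longleftrightarrow> \<rho>x \<in> P2 \<Theta> \<and> distr \<rho>x borel G = \<rho>y"

text \<open>The measure \<open>\<rho>\<close> regarded as a measure on a set \<open>R\<close> that contains its support. As a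
  measurable image, \<open>R\<close> need not be Borel, and \<open>restrict_space \<rho> R\<close> would then be meaningless. But \<open>R\<close> always
  belongs to the completion of \<open>\<rho>\<close>, since it contains the closed set \<open>msupport \<rho>\<close> of full measure.
  If \<open>R\<close> is Borel, the completion makes no difference to the measure of Borel sets.\<close>

definition measure_on :: "'a measure \<Rightarrow> 'a set \<Rightarrow> 'a measure" where
  "measure_on \<rho> R = restrict_space (completion \<rho>) R"

text \<open>Ties are allowed: any measurable choice among the minimizers qualifies. The values of \<open>H\<close>
  outside \<open>G ` \<Theta>\<close> are irrelevant.\<close>

definition min_norm_selection ::
    "'a::euclidean_space set \<Rightarrow> ('a \<Rightarrow> 'b::euclidean_space) \<Rightarrow> ('b \<Rightarrow> 'a) \<Rightarrow> bool" where
  "min_norm_selection \<Theta> G H \<longleftrightarrow>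
     H \<in> borel_on (G ` \<Theta>) \<rightarrow>\<^sub>M borel_on \<Theta> \<and>
     (\<forall>y \<in> G ` \<Theta>. is_arg_min (\<lambda>x. (norm x)\<^sup>2) (\<lambda>x. x \<in> \<Theta> \<and> G x = y) (H y))"

end

theory Submission
  imports Defs
begin

text \<open>Why the theorem is true. Let \<open>R = G ` \<Theta>\<close>. Any feasible \<open>\<rho>x\<close> can be improved point by point: move
  the mass at \<open>x\<close> to \<open>H (G x)\<close>, the selected point of least norm in the fibre of \<open>G\<close> through \<open>x\<close>. This
  keeps \<open>G\<close> unchanged, because \<open>G (H y) = y\<close> on \<open>R\<close>, and does not increase the second moment,
  because \<open>norm (H (G x)) \<le> norm x\<close>.

  The improved measure \<open>(H \<circ> G)\<^sub># \<rho>x\<close> does not depend on \<open>\<rho>x\<close>: since \<open>G\<^sub># \<rho>x = \<rho>y\<close>, it is \<open>H\<^sub># \<rho>y\<close>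
  (lemma \<open>distr_measure_on_eq\<close>). So \<open>H\<^sub># \<rho>y\<close> is feasible, as the improvement of some feasible
  measure, and it costs no more than any feasible measure, being the improvement of each of them.

  The measure-theoretic care goes into \<open>R\<close>, which may fail to be Borel. It contains the support of
  \<open>\<rho>y\<close>, whose complement is null by second countability (lemma \<open>null_sets_Compl_msupport\<close>), so \<open>R\<close>
  belongs to the completion of \<open>\<rho>y\<close> and passing to \<open>R\<close> loses no mass (lemma \<open>emeasure_measure_on\<close>).\<close>

text \<open>Every point outside the support lies in a null member of a fixed countable basis, and these
  members do not meet the support. So the complement is a countable union of null sets.\<close>

lemma null_sets_Compl_msupport:
  fixes \<rho> :: "'a::second_countable_topology measure"
  assumes sets: "sets \<rho> = sets borel"
  shows "- msupport \<rho> \<in> null_sets \<rho>"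
proof -
  obtain \<B> :: "'a set set" where \<B>: "countable \<B>" "topological_basis \<B>"
    using ex_countable_basis by blast
  define \<N> where "\<N> = {U \<in> \<B>. emeasure \<rho> U = 0}"
  have "\<N> \<subseteq> null_sets \<rho>"
    using topological_basis_open[OF \<B>(2)] by (auto simp: \<N>_def null_sets_def sets)
  moreover have "countable \<N>"
    using \<B>(1) by (simp add: \<N>_def)
  ultimately have "\<Union>\<N> \<in> null_sets \<rho>"
    using null_sets_UN'[of \<N> "\<lambda>U. U" \<rho>] by auto
  moreover have "- msupport \<rho> = \<Union>\<N>"
  proof (intro equalityI subsetI)
    fix x assume "x \<in> - msupport \<rho>"
    then obtain U where U: "open U" "x \<in> U" "emeasure \<rho> U = 0"
      by (auto simp: msupport_def)
    obtain V where V: "V \<in> \<B>" "x \<in> V" "V \<subseteq> U"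
      using topological_basisE[OF \<B>(2) U(1,2)] by blast
    have "emeasure \<rho> V \<le> emeasure \<rho> U"
      using V(3) U(1) by (intro emeasure_mono) (auto simp: sets)
    with V U(3) show "x \<in> \<Union>\<N>"
      by (auto simp: \<N>_def)
  next
    fix x assume "x \<in> \<Union>\<N>"
    then show "x \<in> - msupport \<rho>"
      using topological_basis_open[OF \<B>(2)] by (force simp: \<N>_def msupport_def)
  qed
  ultimately show ?thesis by simp
qed

lemma space_measure_on:
  assumes "sets \<rho> = sets borel"
  shows "space (measure_on \<rho> R) = R"
  using sets_eq_imp_space_eq[OF assms] by (simp add: measure_on_def space_restrict_space)

lemma sets_borel_on_le_measure_on:
  assumes "sets \<rho> = sets borel"
  shows "sets (borel_on R) \<subseteq> sets (measure_on \<rho> R)"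
  using assms by (auto simp: measure_on_def sets_restrict_space)

lemma measurable_measure_on:
  assumes "sets \<rho> = sets borel" and "f \<in> borel_on R \<rightarrow>\<^sub>M N"
  shows "f \<in> measure_on \<rho> R \<rightarrow>\<^sub>M N"
  using assms(2) sets_borel_on_le_measure_on[OF assms(1), of R] space_measure_on[OF assms(1), of R]
  by (auto simp: measurable_def space_restrict_space)

text \<open>The part of \<open>B\<close> lost by passing to \<open>R\<close> lies outside the support, hence is null. The same
  remark puts \<open>R\<close> itself into the completion.\<close>

lemma emeasure_measure_on:
  fixes \<rho> :: "'a::second_countable_topology measure"
  assumes sets: "sets \<rho> = sets borel" and supp: "msupport \<rho> \<subseteq> R" and B: "B \<in> sets borel"
  shows "emeasure (measure_on \<rho> R) (B \<inter> R) = emeasure \<rho> B"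
proof -
  have space: "space \<rho> = UNIV"
    using sets_eq_imp_space_eq[OF sets] by simp
  have null: "- R \<in> null_sets (completion \<rho>)"
  proof (rule null_sets_completion_subset)
    show "- R \<subseteq> - msupport \<rho>"
      using supp by simp
    show "- msupport \<rho> \<in> null_sets (completion \<rho>)"
      by (intro null_sets_completionI null_sets_Compl_msupport sets)
  qed
  have "space (completion \<rho>) - (- R) \<in> sets (completion \<rho>)"
    using null by (intro sets.compl_sets null_setsD2)
  then have R: "R \<in> sets (completion \<rho>)"
    by (simp only: space_completion space Compl_eq_Diff_UNIV[symmetric] double_complement)
  have B': "B \<in> sets (completion \<rho>)"
    using B sets by auto
  have "emeasure (measure_on \<rho> R) (B \<inter> R) = emeasure (completion \<rho>) (B \<inter> R)"
    unfolding measure_on_def using R space by (intro emeasure_restrict_space) auto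
  also have "\<dots> = emeasure (completion \<rho>) (B - (- R))"
    by (simp add: Diff_eq)
  also have "\<dots> = emeasure (completion \<rho>) B"
    by (rule emeasure_Diff_null_set[OF null B'])
  also have "\<dots> = emeasure \<rho> B"
    using B sets by simp
  finally show ?thesis .
qed

text \<open>On the trace \<open>\<sigma>\<close>-algebra of \<open>R\<close>, the pushforward of \<open>\<rho>x\<close> under \<open>G\<close> and the measure \<open>\<rho>y\<close>
  regarded on \<open>R\<close> agree; applying \<open>H\<close> to both gives the claim.\<close>

lemma distr_measure_on_eq:
  fixes \<rho>y :: "'b::second_countable_topology measure"
  assumes sets: "sets \<rho>y = sets borel" and supp: "msupport \<rho>y \<subseteq> R"
    and G: "G \<in> \<rho>x \<rightarrow>\<^sub>M borel_on R" and push: "distr \<rho>x borel G = \<rho>y"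
    and H: "H \<in> borel_on R \<rightarrow>\<^sub>M N"
  shows "distr (measure_on \<rho>y R) N H = distr \<rho>x N (H \<circ> G)"
proof -
  have id: "(\<lambda>y. y) \<in> measure_on \<rho>y R \<rightarrow>\<^sub>M borel_on R"
    by (intro measurable_measure_on sets measurable_ident_sets refl)
  have GR: "G x \<in> R" if "x \<in> space \<rho>x" for x
    using measurable_space[OF G that] by (simp add: space_restrict_space)
  have G': "G \<in> \<rho>x \<rightarrow>\<^sub>M borel"
    using G by (simp add: measurable_restrict_space2_iff)
  have eq: "distr (measure_on \<rho>y R) (borel_on R) (\<lambda>y. y) = distr \<rho>x (borel_on R) G"
  proof (rule measure_eqI)
    fix A assume "A \<in> sets (distr (measure_on \<rho>y R) (borel_on R) (\<lambda>y. y))"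
    then have A: "A \<in> sets (borel_on R)" by simp
    then obtain B where B: "B \<in> sets borel" "A = B \<inter> R"
      by (auto simp: sets_restrict_space)
    have "emeasure (distr (measure_on \<rho>y R) (borel_on R) (\<lambda>y. y)) A
        = emeasure (measure_on \<rho>y R) (B \<inter> R)"
      using A B by (simp add: emeasure_distr[OF id] space_measure_on[OF sets] Int_absorb2)
    also have "\<dots> = emeasure \<rho>y B"
      by (rule emeasure_measure_on[OF sets supp B(1)])
    also have "\<dots> = emeasure \<rho>x (G -` B \<inter> space \<rho>x)"
      using emeasure_distr[OF G' B(1)] push by simp
    also have "G -` B \<inter> space \<rho>x = G -` A \<inter> space \<rho>x"
      using GR B(2) by auto
    also have "emeasure \<rho>x \<dots> = emeasure (distr \<rho>x (borel_on R) G) A"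
      using A by (simp add: emeasure_distr[OF G])
    finally show "emeasure (distr (measure_on \<rho>y R) (borel_on R) (\<lambda>y. y)) A
        = emeasure (distr \<rho>x (borel_on R) G) A" .
  qed simp
  have "distr (measure_on \<rho>y R) N H = distr (distr (measure_on \<rho>y R) (borel_on R) (\<lambda>y. y)) N H"
    by (simp add: distr_distr[OF H id] comp_def)
  also have "\<dots> = distr \<rho>x N (H \<circ> G)"
    by (simp add: eq distr_distr[OF H G])
  finally show ?thesis .
qed

text \<open>One improvement step: replacing each point of \<open>\<Theta>\<close> by a point of the same fibre with no larger
  norm keeps a measure feasible and does not increase its second moment.\<close>

lemma feasible_distr_norm_decreasing:
  fixes T :: "'a::euclidean_space \<Rightarrow> 'a" and G :: "'a \<Rightarrow> 'b::euclidean_space"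
  assumes feas: "feasible \<Theta> G \<rho>y \<rho>x" and G: "G \<in> borel_on \<Theta> \<rightarrow>\<^sub>M borel"
    and T: "T \<in> borel_on \<Theta> \<rightarrow>\<^sub>M borel_on \<Theta>"
    and fibre: "\<And>x. x \<in> \<Theta> \<Longrightarrow> G (T x) = G x"
    and le: "\<And>x. x \<in> \<Theta> \<Longrightarrow> (norm (T x))\<^sup>2 \<le> (norm x)\<^sup>2"
  shows "feasible \<Theta> G \<rho>y (distr \<rho>x (borel_on \<Theta>) T)"
    and "(\<integral>x. (norm x)\<^sup>2 \<partial>distr \<rho>x (borel_on \<Theta>) T) \<le> (\<integral>x. (norm x)\<^sup>2 \<partial>\<rho>x)"
proof -
  interpret prob_space \<rho>x
    using feas by (simp add: feasible_def P2_def)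
  have sets: "sets \<rho>x = sets (borel_on \<Theta>)" and int: "integrable \<rho>x (\<lambda>x. (norm x)\<^sup>2)"
    and push: "distr \<rho>x borel G = \<rho>y"
    using feas by (auto simp: feasible_def P2_def)
  have space: "space \<rho>x = \<Theta>"
    using sets_eq_imp_space_eq[OF sets] by (simp add: space_restrict_space)
  have T': "T \<in> \<rho>x \<rightarrow>\<^sub>M borel_on \<Theta>"
    using T by (simp add: measurable_cong_sets[OF sets refl])
  have norm: "(\<lambda>x. (norm x)\<^sup>2) \<in> borel_measurable (borel_on \<Theta>)"
    by (intro measurable_restrict_space1) measurable
  have int': "integrable \<rho>x (\<lambda>x. (norm (T x))\<^sup>2)"
    by (rule Bochner_Integration.integrable_bound[OF int])
      (use measurable_compose[OF T' norm] le space in auto)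
  have "distr (distr \<rho>x (borel_on \<Theta>) T) borel G = distr \<rho>x borel (G \<circ> T)"
    by (rule distr_distr[OF G T'])
  also have "\<dots> = distr \<rho>x borel G"
    by (rule distr_cong) (simp_all add: space fibre)
  finally show "feasible \<Theta> G \<rho>y (distr \<rho>x (borel_on \<Theta>) T)"
    using prob_space_distr[OF T'] int'
    by (simp add: feasible_def P2_def push integrable_distr_eq[OF T' norm])
  show "(\<integral>x. (norm x)\<^sup>2 \<partial>distr \<rho>x (borel_on \<Theta>) T) \<le> (\<integral>x. (norm x)\<^sup>2 \<partial>\<rho>x)"
    unfolding integral_distr[OF T' norm]
    by (rule integral_mono[OF int' int]) (use le space in blast)
qed

theorem theorem3p2:
  fixes \<Theta> :: "(real ^ 'm) set"
    and G :: "real ^ 'm \<Rightarrow> real ^ 'n"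
    and H :: "real ^ 'n \<Rightarrow> real ^ 'm"
    and \<rho>y :: "(real ^ 'n) measure"
  assumes "G \<in> borel_on \<Theta> \<rightarrow>\<^sub>M borel"
    and "prob_space \<rho>y" and "sets \<rho>y = sets borel"
    and "msupport \<rho>y \<subseteq> G ` \<Theta>"
    and "\<exists>\<rho>x. feasible \<Theta> G \<rho>y \<rho>x"
    and "min_norm_selection \<Theta> G H"
  shows "is_arg_min (\<lambda>\<rho>x. \<integral>x. (norm x)\<^sup>2 \<partial>\<rho>x) (feasible \<Theta> G \<rho>y)
           (distr (measure_on \<rho>y (G ` \<Theta>)) (borel_on \<Theta>) H)"
proof -
  let ?\<mu> = "distr (measure_on \<rho>y (G ` \<Theta>)) (borel_on \<Theta>) H"
  have H: "H \<in> borel_on (G ` \<Theta>) \<rightarrow>\<^sub>M borel_on \<Theta>"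
    and min: "\<And>x. x \<in> \<Theta> \<Longrightarrow> is_arg_min (\<lambda>z. (norm z)\<^sup>2) (\<lambda>z. z \<in> \<Theta> \<and> G z = G x) (H (G x))"
    using assms(6) by (auto simp: min_norm_selection_def)
  have G: "G \<in> borel_on \<Theta> \<rightarrow>\<^sub>M borel_on (G ` \<Theta>)"
    using assms(1) by (intro measurable_restrict_space2) (auto simp: space_restrict_space)
  have fibre: "G ((H \<circ> G) x) = G x" and le: "(norm ((H \<circ> G) x))\<^sup>2 \<le> (norm x)\<^sup>2" if "x \<in> \<Theta>" for x
    using min[OF that] that by (auto simp: is_arg_min_linorder)
  have improve: "feasible \<Theta> G \<rho>y ?\<mu> \<and> (\<integral>x. (norm x)\<^sup>2 \<partial>?\<mu>) \<le> (\<integral>x. (norm x)\<^sup>2 \<partial>\<rho>x)"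
    if feas: "feasible \<Theta> G \<rho>y \<rho>x" for \<rho>x
  proof -
    have sets: "sets \<rho>x = sets (borel_on \<Theta>)" and push: "distr \<rho>x borel G = \<rho>y"
      using feas by (auto simp: feasible_def P2_def)
    have "G \<in> \<rho>x \<rightarrow>\<^sub>M borel_on (G ` \<Theta>)"
      using G by (simp add: measurable_cong_sets[OF sets refl])
    then have "?\<mu> = distr \<rho>x (borel_on \<Theta>) (H \<circ> G)"
      by (rule distr_measure_on_eq[OF assms(3,4) _ push H])
    then show ?thesis
      using feasible_distr_norm_decreasing[OF feas assms(1) measurable_comp[OF G H] fibre le]
      by (simp add: comp_def)
  qed
  then show ?thesis
    using assms(5) by (auto simp: is_arg_min_linorder)
qed

end
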